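(* If $\mathbf{a}=(a_1,\dots,a_n)$ is a weak composition that is not pure, then $\mathcal{P}(\mathbb{D}(\mathbf{a}))$ is not ranked.
   Context: A diagram is a finite set $D$ of cells $(r,c)$ with $r,c$ positive integers; $r$ is the row (rows numbered from bottom to top starting at 1) and $c$ the column (numbered from left to right starting at 1). A Kohnert move at row $r$ applied to a diagram $D$: if row $r$ of $D$ is empty, $D$ is unchanged; otherwise let $(r,c)$ be the cell of row $r$ with the largest column index; if every position $(r',c)$ with $1\le r'<r$ belongs to $D$, then $D$ is unchanged; otherwise let $r'$ be the largest integer with $1\le r'<r$ and $(r',c)\notin D$, and the move replaces the cell $(r,c)$ by $(r',c)$. For a diagram $D_0$, $KD(D_0)$ is the set of all diagrams obtainable from $D_0$ by finite (possibly empty) sequences of Kohnert moves; the Kohnert poset $\mathcal{P}(D_0)$ is $KD(D_0)$ ordered by $D_2\preceq D_1$ iff $D_2$ can be obtained from $D_1$ by a finite sequence of Kohnert moves. A finite poset $P$ is ranked if there is a function $\rho:P\to\mathbb{Z}_{\ge0}$ such that $x\prec y$ implies $\rho(x)<\rho(y)$ and $\rho(y)=\rho(x)+1$ whenever $y$ covers $x$. For a weak composition $\mathbf{a}=(a_1,\dots,a_n)\in\mathbb{Z}_{\ge0}^n$, the key diagram is $\mathbb{D}(\mathbf{a})=\bigcup_{i=1}^n\{(i,j):1\le j\le a_i\}$. The weak composition $\mathbf{a}$ is pure if there are no indices $1\le j_1<j_2<j_3\le n$ with $a_{j_1}<a_{j_2}<a_{j_3}$, or $a_{j_1}<a_{j_3}<a_{j_2}$,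 or $a_{j_1}+1<a_{j_2}=a_{j_3}$. *)

theory Defs
  imports Main
begin

text \<open>A cell is a pair (row, column); rows are numbered from bottom to top and columns from left
  to right, both starting at 1.\<close>

type_synonym cell = "nat \<times> nat"

definition is_diagram :: "cell set \<Rightarrow> bool" where
  "is_diagram D \<longleftrightarrow> finite D \<and> (\<forall>(r, c) \<in> D. 1 \<le> r \<and> 1 \<le> c)"

definition kohnert_move :: "nat \<Rightarrow> cell set \<Rightarrow> cell set" where
  "kohnert_move r D =
    (if {c. (r, c) \<in> D} = {} then D
     else let c = Max {c. (r, c) \<in> D};
              F = {r'. 1 \<le> r' \<and> r' < r \<and> (r', c) \<notin> D}
          in if F = {} then D else insert (Max F, c) (D - {(r, c)}))"

definition kohnert_step :: "cell set rel" where
  "kohnert_step = {(D, kohnert_move r D) | D r. 1 \<le> r}"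

definition KD :: "cell set \<Rightarrow> cell set set" where
  "KD D0 = {D. (D0, D) \<in> kohnert_step\<^sup>*}"

text \<open>The order of the Kohnert poset on the carrier \<^term>\<open>KD D0\<close>; a pair \<open>(D2, D1)\<close> means that
  \<open>D2\<close> lies below \<open>D1\<close>.\<close>

definition kohnert_order :: "cell set \<Rightarrow> cell set rel" where
  "kohnert_order D0 = {(D2, D1). D1 \<in> KD D0 \<and> D2 \<in> KD D0 \<and> (D1, D2) \<in> kohnert_step\<^sup>*}"

definition covered_by :: "'a set \<Rightarrow> 'a rel \<Rightarrow> 'a \<Rightarrow> 'a \<Rightarrow> bool" where
  "covered_by P R x y \<longleftrightarrow> x \<in> P \<and> y \<in> P \<and> (x, y) \<in> R \<and> x \<noteq> y \<and>
    \<not> (\<exists>z\<in>P. (x, z) \<in> R \<and> x \<noteq> z \<and> (z, y) \<in> R \<and> z \<noteq> y)"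

text \<open>To be used for finite posets, i.e. \<^term>\<open>finite P\<close> and \<^term>\<open>partial_order_on P R\<close>;
  for Kohnert posets this is proved at the end of this theory.\<close>

definition ranked :: "'a set \<Rightarrow> 'a rel \<Rightarrow> bool" where
  "ranked P R \<longleftrightarrow> (\<exists>\<rho> :: 'a \<Rightarrow> nat.
     (\<forall>x\<in>P. \<forall>y\<in>P. (x, y) \<in> R \<and> x \<noteq> y \<longrightarrow> \<rho> x < \<rho> y) \<and>
     (\<forall>x\<in>P. \<forall>y\<in>P. covered_by P R x y \<longrightarrow> \<rho> y = \<rho> x + 1))"

text \<open>A weak composition \<open>(a\<^sub>1, \<dots>, a\<^sub>n)\<close> is a list of length \<open>n\<close>, so \<open>a\<^sub>i\<close> is \<open>a ! (i - 1)\<close>.\<close>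

definition key_diagram :: "nat list \<Rightarrow> cell set" where
  "key_diagram a = (\<Union>i\<in>{1..length a}. {(i, j) | j. 1 \<le> j \<and> j \<le> a ! (i - 1)})"

definition pure_composition :: "nat list \<Rightarrow> bool" where
  "pure_composition a \<longleftrightarrow> \<not> (\<exists>j1 j2 j3. j1 < j2 \<and> j2 < j3 \<and> j3 < length a \<and>
     (a ! j1 < a ! j2 \<and> a ! j2 < a ! j3 \<or>
      a ! j1 < a ! j3 \<and> a ! j3 < a ! j2 \<or>
      a ! j1 + 1 < a ! j2 \<and> a ! j2 = a ! j3))"

lemma is_diagram_key_diagram: "is_diagram (key_diagram a)"
  by (auto simp: is_diagram_def key_diagram_def)

lemma kohnert_move_cases:
  assumes "is_diagram D"
  shows "kohnert_move r D = D \<or>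
    (\<exists>r' c. 1 \<le> r' \<and> r' < r \<and> (r, c) \<in> D \<and> (r', c) \<notin> D \<and>
            kohnert_move r D = insert (r', c) (D - {(r, c)}))"
proof (cases "kohnert_move r D = D")
  case False
  define C where "C = {c. (r, c) \<in> D}"
  define F where "F = {r'. 1 \<le> r' \<and> r' < r \<and> (r', Max C) \<notin> D}"
  have C: "C \<noteq> {}" and F: "F \<noteq> {}"
    and eq: "kohnert_move r D = insert (Max F, Max C) (D - {(r, Max C)})"
    using False by (auto simp: kohnert_move_def C_def F_def Let_def split: if_splits)
  have "C \<subseteq> snd ` D" by (force simp: C_def)
  then have "finite C" using assms by (auto simp: is_diagram_def intro: finite_subset)
  then have "Max C \<in> C" using C Max_in by blast
  moreover have "Max F \<in> F" using F by (intro Max_in) (auto simp: F_def)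
  ultimately show ?thesis using eq by (auto simp: C_def F_def)
qed simp

lemma kohnert_move_decreases:
  assumes D: "is_diagram D" and sub: "D \<subseteq> {..N} \<times> C"
  shows "is_diagram (kohnert_move r D)"
    and "kohnert_move r D \<subseteq> {..N} \<times> C"
    and "kohnert_move r D = D \<or> sum fst (kohnert_move r D) < sum fst D"
proof -
  have fin: "finite D" using D by (simp add: is_diagram_def)
  consider "kohnert_move r D = D" | r' c where "1 \<le> r'" "r' < r" "(r, c) \<in> D" "(r', c) \<notin> D"
    "kohnert_move r D = insert (r', c) (D - {(r, c)})"
    using kohnert_move_cases[OF D] by blast
  then have "is_diagram (kohnert_move r D) \<and> kohnert_move r D \<subseteq> {..N} \<times> C \<and>
    (kohnert_move r D = D \<or> sum fst (kohnert_move r D) < sum fst D)"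
  proof cases
    case 1
    then show ?thesis using D sub by simp
  next
    case (2 r' c)
    have "sum fst D = r + sum fst (D - {(r, c)})"
      using fin 2(3) by (simp add: sum.remove)
    moreover have "sum fst (kohnert_move r D) = r' + sum fst (D - {(r, c)})"
      using fin 2(4,5) by simp
    moreover have "is_diagram (kohnert_move r D)"
      using D 2(1,3,5) by (auto simp: is_diagram_def)
    moreover have "r \<le> N" "c \<in> C" using sub 2(3) by auto
    then have "kohnert_move r D \<subseteq> {..N} \<times> C"
      using sub 2(2) unfolding 2(5) by auto
    ultimately show ?thesis using 2(2) by simp
  qed
  then show "is_diagram (kohnert_move r D)" "kohnert_move r D \<subseteq> {..N} \<times> C"
    "kohnert_move r D = D \<or> sum fst (kohnert_move r D) < sum fst D"
    by blast+
qed

lemma kohnert_steps_decrease: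
  assumes "(D, E) \<in> kohnert_step\<^sup>*" "is_diagram D" "D \<subseteq> {..N} \<times> C"
  shows "is_diagram E \<and> E \<subseteq> {..N} \<times> C \<and> (E = D \<or> sum fst E < sum fst D)"
  using assms(1)
proof (induction rule: rtrancl_induct)
  case base
  then show ?case using assms by simp
next
  case (step E E')
  then obtain r where E': "E' = kohnert_move r E" by (auto simp: kohnert_step_def)
  have E: "is_diagram E" "E \<subseteq> {..N} \<times> C" "E = D \<or> sum fst E < sum fst D"
    using step.IH by auto
  show ?case using kohnert_move_decreases[OF E(1,2), of r] E(3) unfolding E' by auto
qed

lemma is_diagram_bounded:
  assumes "is_diagram D"
  shows "D \<subseteq> {..Max (fst ` D)} \<times> snd ` D"
proof
  fix x assume x: "x \<in> D"
  then have "fst x \<le> Max (fst ` D)" using assms by (simp add: is_diagram_def)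
  then show "x \<in> {..Max (fst ` D)} \<times> snd ` D" using x by (simp add: mem_Times_iff)
qed

lemma finite_KD:
  assumes "is_diagram D0"
  shows "finite (KD D0)"
proof (rule finite_subset)
  show "KD D0 \<subseteq> Pow ({..Max (fst ` D0)} \<times> (snd ` D0))"
    using kohnert_steps_decrease[OF _ assms is_diagram_bounded[OF assms]]
    unfolding KD_def by blast
  show "finite (Pow ({..Max (fst ` D0)} \<times> (snd ` D0)))"
    using assms by (simp add: is_diagram_def)
qed

lemma partial_order_on_kohnert_order:
  assumes "is_diagram D0"
  shows "partial_order_on (KD D0) (kohnert_order D0)"
  unfolding partial_order_on_def preorder_on_def
proof (intro conjI)
  show "refl_on (KD D0) (kohnert_order D0)"
    by (auto simp: refl_on_def kohnert_order_def)
  show "trans (kohnert_order D0)"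
    by (auto simp: trans_def kohnert_order_def)
  show "antisym (kohnert_order D0)"
  proof (rule antisymI)
    fix D E assume "(D, E) \<in> kohnert_order D0" "(E, D) \<in> kohnert_order D0"
    then have *: "(E, D) \<in> kohnert_step\<^sup>*" "(D, E) \<in> kohnert_step\<^sup>*" "D \<in> KD D0" "E \<in> KD D0"
      by (auto simp: kohnert_order_def)
    then have "is_diagram D" "is_diagram E"
      using kohnert_steps_decrease[OF _ assms is_diagram_bounded[OF assms]]
      unfolding KD_def by blast+
    then have "E = D \<or> sum fst E < sum fst D" "D = E \<or> sum fst D < sum fst E"
      using kohnert_steps_decrease[OF *(2)] kohnert_steps_decrease[OF *(1)] is_diagram_bounded
      by blast+
    then show "D = E" by auto
  qed
  show "kohnert_order D0 \<subseteq> KD D0 \<times> KD D0"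
    by (auto simp: kohnert_order_def)
qed

end

theory Submission
  imports Defs
begin

text \<open>A ranked poset cannot have saturated chains of lengths 2 and 3 between the same two elements.
  Such a pair comes from a cell \<open>(b + 2, c)\<close> jumping over \<open>(b + 1, c)\<close> to \<open>(b, c)\<close>: the jump is
  a cover when the obstacle is held in place by a cell to its right, whereas the obstacle can instead
  be moved first, before the holding cell arrives (\<open>not_ranked_arriving\<close>) or after it has
  left (\<open>not_ranked_leaving\<close>).  For a bad triple \<open>j1 < j2 < j3\<close> with \<open>j3\<close> least, the rows
  between the chosen indices are so restricted that, in the columns \<open>\<ge> c\<close>, the cells can be lowered to
  one of these two configurations; rows above \<open>j3\<close> and columns below \<open>c\<close> never play a role.\<close>

section \<open>Kohnert moves\<close>

lemma kohnert_move_eq: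
  assumes "is_diagram D" "(r, c) \<in> D" "\<forall>i>c. (r, i) \<notin> D" "1 \<le> t" "t < r" "(t, c) \<notin> D"
    "\<forall>u. t < u \<and> u < r \<longrightarrow> (u, c) \<in> D"
  shows "kohnert_move r D = insert (t, c) (D - {(r, c)})"
proof -
  let ?C = "{c. (r, c) \<in> D}" and ?F = "{r'. 1 \<le> r' \<and> r' < r \<and> (r', c) \<notin> D}"
  have "?C \<subseteq> snd ` D" by force
  then have "finite ?C" using assms(1) by (auto simp: is_diagram_def intro: finite_subset)
  then have C: "Max ?C = c"
    using assms(2,3) by (intro Max_eqI) (auto simp flip: not_less)
  have F: "Max ?F = t"
    using assms(4-) by (intro Max_eqI) (auto simp flip: not_less)
  have "?C \<noteq> {}" "?F \<noteq> {}" using assms(2,4-6) by auto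
  then show ?thesis by (simp only: kohnert_move_def Let_def C F if_False)
qed

lemma kohnert_step_moveI:
  assumes "is_diagram D" "(r, c) \<in> D" "\<forall>i>c. (r, i) \<notin> D" "1 \<le> t" "t < r" "(t, c) \<notin> D"
    "\<forall>u. t < u \<and> u < r \<longrightarrow> (u, c) \<in> D"
  shows "(D, insert (t, c) (D - {(r, c)})) \<in> kohnert_step"
proof -
  have "1 \<le> r" using assms(4,5) by simp
  then show ?thesis using kohnert_move_eq[OF assms] unfolding kohnert_step_def by force
qed

lemma kohnert_step_cases:
  assumes "(D, E) \<in> kohnert_step" "is_diagram D" "E \<noteq> D"
  obtains r c t where "(r, c) \<in> D" "\<forall>i>c. (r, i) \<notin> D" "1 \<le> t" "t < r" "(t, c) \<notin> D"
    "E = kohnert_move r D" "E = insert (t, c) (D - {(r, c)})"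
proof -
  obtain r where E: "E = kohnert_move r D" using assms(1) by (auto simp: kohnert_step_def)
  let ?C = "{c. (r, c) \<in> D}"
  let ?F = "{r'. 1 \<le> r' \<and> r' < r \<and> (r', Max ?C) \<notin> D}"
  have ne: "?C \<noteq> {}" "?F \<noteq> {}" and E': "E = insert (Max ?F, Max ?C) (D - {(r, Max ?C)})"
    using assms(3) unfolding E by (auto simp: kohnert_move_def Let_def split: if_splits)
  have "?C \<subseteq> snd ` D" by force
  then have fin: "finite ?C" using assms(2) by (auto simp: is_diagram_def intro: finite_subset)
  have "Max ?C \<in> ?C" using Max_in[OF fin ne(1)] .
  moreover have "\<forall>i>Max ?C. (r, i) \<notin> D" using Max_ge[OF fin] by (auto simp flip: not_less)
  moreover have "Max ?F \<in> ?F" using ne(2) by (intro Max_in) auto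
  ultimately show thesis using that[of r "Max ?C" "Max ?F"] E E' by blast
qed

lemma is_diagram_kohnert_steps:
  "(D, E) \<in> kohnert_step\<^sup>* \<Longrightarrow> is_diagram D \<Longrightarrow> is_diagram E"
  using kohnert_steps_decrease is_diagram_bounded by blast

text \<open>A move lowers one cell within its column, so a total weight that grows weakly with the
  row cannot increase. Taken with the indicator of the upper part of a column, this bounds which
  cells can have moved along a chain.\<close>

lemma sum_kohnert_steps_le:
  fixes w :: "cell \<Rightarrow> nat"
  assumes "(D, E) \<in> kohnert_step\<^sup>*" "is_diagram D" "\<And>r t c. t \<le> r \<Longrightarrow> w (t, c) \<le> w (r, c)"
  shows "sum w E \<le> sum w D"
  using assms(1)
proof (induction rule: rtrancl_induct)
  case (step E E')
  have E: "is_diagram E" using step.hyps(1) assms(2) by (rule is_diagram_kohnert_steps)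
  have "sum w E' \<le> sum w E"
  proof (cases "E' = E")
    case False
    obtain r c t where *: "(r, c) \<in> E" "t < r" "(t, c) \<notin> E" "E' = insert (t, c) (E - {(r, c)})"
      using kohnert_step_cases[OF step.hyps(2) E False] by metis
    have "finite E" using E by (simp add: is_diagram_def)
    then show ?thesis using *(1,3) assms(3)[of t r c] *(2) unfolding *(4)
      by (simp add: sum.remove[of E "(r, c)"])
  qed simp
  then show ?case using step.IH by simp
qed simp

section \<open>Covers\<close>

text \<open>The first step loses a cell from some upper column part, and no later step can restore
  that count. The target must therefore show the same loss, which leaves only rows above
  \<open>t\<close> up to \<open>r\<close> in column \<open>c\<close>. Rows strictly between are
  excluded because their rightmost cell lies to the right of \<open>c\<close>.\<close>

lemma kohnert_move_unique_first_step:
  assumes D: "is_diagram D" and rc: "(r, c) \<in> D" "\<forall>i>c. (r, i) \<notin> D"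
    and t: "1 \<le> t" "t < r" "(t, c) \<notin> D"
    and held: "\<forall>u. t < u \<and> u < r \<longrightarrow> (u, c) \<in> D \<and> (\<exists>i>c. (u, i) \<in> D)"
    and step: "(D, D1) \<in> kohnert_step" "D1 \<noteq> D"
    and below: "(D1, insert (t, c) (D - {(r, c)})) \<in> kohnert_step\<^sup>*"
  shows "D1 = insert (t, c) (D - {(r, c)})"
proof -
  obtain r1 c1 t1 where 1: "(r1, c1) \<in> D" "\<forall>i>c1. (r1, i) \<notin> D" "t1 < r1" "(t1, c1) \<notin> D"
    and D1: "D1 = kohnert_move r1 D" "D1 = insert (t1, c1) (D - {(r1, c1)})"
    using kohnert_step_cases[OF step(1) D step(2)] by metis
  \<comment> \<open>The sum of \<open>w\<close> counts the cells of column \<open>c1\<close> in rows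
    from \<open>r1\<close> upwards; the first step lowers it by exactly one.\<close>
  define w :: "cell \<Rightarrow> nat" where "w = (\<lambda>(x, y). of_bool (y = c1 \<and> r1 \<le> x))"
  have fin: "finite D" using D by (simp add: is_diagram_def)
  have "is_diagram D1" using is_diagram_kohnert_steps[OF r_into_rtrancl[OF step(1)] D] .
  then have "sum w (insert (t, c) (D - {(r, c)})) \<le> sum w D1"
    by (rule sum_kohnert_steps_le[OF below]) (auto simp: w_def)
  moreover have "Suc (sum w D1) = sum w D"
    using fin 1 unfolding D1(2) by (simp add: sum.remove[of D "(r1, c1)"] w_def)
  moreover have "sum w (insert (t, c) (D - {(r, c)})) + w (r, c) = sum w D + w (t, c)"
    using fin rc t by (simp add: sum.remove[of D "(r, c)"])
  ultimately have "w (t, c) < w (r, c)" by linarith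
  then have "c = c1" "r1 \<le> r" "t < r1"
    using t(2) by (auto simp: w_def of_bool_def split: if_splits)
  then have "r1 = r" using held 1(2) by (metis le_neq_implies_less)
  then show ?thesis using kohnert_move_eq[OF D rc t] held D1(1) by blast
qed

text \<open>In \<open>held\<close>, the cell \<open>(u, c)\<close> makes the moving cell jump over
  row \<open>u\<close>, and the cell to its right keeps row \<open>u\<close> from moving
  \<open>(u, c)\<close> itself. For adjacent rows the condition is vacuous, so every drop by one row
  is a cover.\<close>

lemma covered_by_kohnert_move:
  assumes D0: "is_diagram D0" "(D0, D) \<in> kohnert_step\<^sup>*"
    and rc: "(r, c) \<in> D" "\<forall>i>c. (r, i) \<notin> D"
    and t: "1 \<le> t" "t < r" "(t, c) \<notin> D"
    and held: "\<forall>u. t < u \<and> u < r \<longrightarrow> (u, c) \<in> D \<and> (\<exists>i>c. (u, i) \<in> D)"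
    and E: "E = insert (t, c) (D - {(r, c)})"
  shows "covered_by (KD D0) (kohnert_order D0) E D"
proof -
  have D: "is_diagram D" using is_diagram_kohnert_steps D0(2,1) .
  have DE: "(D, E) \<in> kohnert_step"
    using kohnert_step_moveI[OF D rc t] held unfolding E by blast
  have "Z = E" if Z: "(D, Z) \<in> kohnert_step\<^sup>*" "(Z, E) \<in> kohnert_step\<^sup>*" and "Z \<noteq> D" for Z
  proof -
    \<comment> \<open>Moves at empty or blocked rows are loops of \<open>kohnert_step\<close>, so
      the first step that changes \<open>D\<close> has to be extracted.\<close>
    have "Z = D \<or> (\<exists>D1. D1 \<noteq> D \<and> (D, D1) \<in> kohnert_step \<and> (D1, Z) \<in> kohnert_step\<^sup>*)"
      using Z(1)
    proof (induction rule: rtrancl_induct)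
      case (step Z Z')
      then show ?case by (meson rtrancl.rtrancl_into_rtrancl rtrancl.rtrancl_refl)
    qed simp
    then obtain D1 where D1: "D1 \<noteq> D" "(D, D1) \<in> kohnert_step" "(D1, Z) \<in> kohnert_step\<^sup>*"
      using \<open>Z \<noteq> D\<close> by blast
    have "(D1, E) \<in> kohnert_step\<^sup>*" using D1(3) Z(2) by (rule rtrancl_trans)
    then have "D1 = E"
      using kohnert_move_unique_first_step[OF D rc t held D1(2,1)] unfolding E by blast
    \<comment> \<open>Once \<open>D1 = E\<close>, the diagrams \<open>Z\<close> and \<open>E\<close>
      are reachable from each other, and antisymmetry in the poset generated by \<open>E\<close>
      identifies them.\<close>
    moreover have "is_diagram E" using is_diagram_kohnert_steps[OF r_into_rtrancl[OF DE] D] .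
    then have "antisym (kohnert_order E)"
      using partial_order_on_kohnert_order unfolding partial_order_on_def by blast
    ultimately show "Z = E"
      using D1(3) Z(2) unfolding antisym_def kohnert_order_def KD_def by blast
  qed
  moreover have "(D0, E) \<in> kohnert_step\<^sup>*" using D0(2) DE by (rule rtrancl_into_rtrancl)
  moreover have "E \<noteq> D" using t(3) unfolding E by blast
  ultimately show ?thesis
    using DE D0(2) unfolding covered_by_def kohnert_order_def KD_def by blast
qed

section \<open>Saturated chains of lengths two and three\<close>

lemma not_ranked_if_unequal_chains:
  assumes "covered_by P R y x" "covered_by P R z y"
    and "covered_by P R u x" "covered_by P R v u" "covered_by P R z v"
  shows "\<not> ranked P R"
proof
  assume "ranked P R"
  then obtain \<rho> :: "'a \<Rightarrow> nat"
    where "\<And>x y. x \<in> P \<Longrightarrow> y \<in> P \<Longrightarrow> covered_by P R x y \<Longrightarrow> \<rho> y = \<rho> x + 1"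
    unfolding ranked_def by blast
  then have "\<And>x y. covered_by P R x y \<Longrightarrow> \<rho> y = \<rho> x + 1"
    by (simp add: covered_by_def)
  from this[OF assms(1)] this[OF assms(2)] this[OF assms(3)] this[OF assms(4)] this[OF assms(5)]
  show False by simp
qed

lemma covered_by_reachable:
  "covered_by (KD D0) (kohnert_order D0) E D \<Longrightarrow> (D0, E) \<in> kohnert_step\<^sup>*"
  by (simp add: covered_by_def KD_def)

text \<open>Short chain \<open>D\<close>, \<open>A\<close>, \<open>B\<close>:
  \<open>(b + 2, c')\<close> drops to row \<open>b + 1\<close> and holds \<open>(b + 1, c)\<close>
  there, then \<open>(b + 2, c)\<close> jumps to \<open>(b, c)\<close>. Long chain \<open>D\<close>,
  \<open>E\<close>, \<open>F\<close>, \<open>B\<close>: \<open>(b + 1, c)\<close> drops first, then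
  \<open>(b + 2, c')\<close>, and finally \<open>(b + 2, c)\<close> drops into the vacated
  \<open>(b + 1, c)\<close>.\<close>

lemma not_ranked_arriving:
  assumes D0: "is_diagram D0" "(D0, D) \<in> kohnert_step\<^sup>*" and b: "1 \<le> b" and c: "c < c'"
    and top: "(b + 2, c) \<in> D" "(b + 2, c') \<in> D" "\<forall>i>c. i \<noteq> c' \<longrightarrow> (b + 2, i) \<notin> D"
    and mid: "(b + 1, c) \<in> D" "\<forall>i>c. (b + 1, i) \<notin> D"
    and bot: "(b, c) \<notin> D"
  shows "\<not> ranked (KD D0) (kohnert_order D0)"
proof -
  note cover = covered_by_kohnert_move[OF D0(1)]
  define A where "A = insert (b + 1, c') (D - {(b + 2, c')})"
  have A: "covered_by (KD D0) (kohnert_order D0) A D"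
    by (rule cover[OF D0(2) top(2) _ _ _ _ _ A_def]) (use c top mid in auto)
  define B where "B = insert (b, c) (A - {(b + 2, c)})"
  have B: "covered_by (KD D0) (kohnert_order D0) B A"
  proof (rule cover[OF covered_by_reachable[OF A] _ _ _ _ _ _ B_def])
    show "\<forall>u. b < u \<and> u < b + 2 \<longrightarrow> (u, c) \<in> A \<and> (\<exists>i>c. (u, i) \<in> A)"
    proof (intro allI impI)
      fix u assume "b < u \<and> u < b + 2"
      then have "u = b + 1" by simp
      then show "(u, c) \<in> A \<and> (\<exists>i>c. (u, i) \<in> A)" using c mid unfolding A_def by auto
    qed
  qed (use b c top mid bot in \<open>auto simp: A_def\<close>)
  define E where "E = insert (b, c) (D - {(b + 1, c)})"
  have E: "covered_by (KD D0) (kohnert_order D0) E D"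
    by (rule cover[OF D0(2) mid(1) _ _ _ _ _ E_def]) (use b mid bot in auto)
  define F where "F = insert (b + 1, c') (E - {(b + 2, c')})"
  have F: "covered_by (KD D0) (kohnert_order D0) F E"
    by (rule cover[OF covered_by_reachable[OF E] _ _ _ _ _ _ F_def])
      (use b c top mid in \<open>auto simp: E_def\<close>)
  have eq: "B = insert (b + 1, c) (F - {(b + 2, c)})"
    using c mid(1) by (auto simp: A_def B_def E_def F_def)
  have "covered_by (KD D0) (kohnert_order D0) B F"
    by (rule cover[OF covered_by_reachable[OF F] _ _ _ _ _ _ eq])
      (use b c top mid in \<open>auto simp: E_def F_def\<close>)
  with A B E F show ?thesis by (intro not_ranked_if_unequal_chains)
qed

text \<open>Short chain \<open>D\<close>, \<open>A\<close>, \<open>B\<close>: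
  \<open>(b + 2, c)\<close> jumps to \<open>(b, c)\<close> while \<open>(b + 1, c')\<close> holds
  the obstacle, then \<open>(b + 1, c')\<close> drops. Long chain \<open>D\<close>,
  \<open>E\<close>, \<open>F\<close>, \<open>B\<close>: \<open>(b + 1, c')\<close> drops first,
  which frees \<open>(b + 1, c)\<close> to drop, and then \<open>(b + 2, c)\<close> takes its
  place.\<close>

lemma not_ranked_leaving:
  assumes D0: "is_diagram D0" "(D0, D) \<in> kohnert_step\<^sup>*" and b: "1 \<le> b" and c: "c < c'"
    and top: "(b + 2, c) \<in> D" "\<forall>i>c. (b + 2, i) \<notin> D"
    and mid: "(b + 1, c) \<in> D" "(b + 1, c') \<in> D" "\<forall>i>c. i \<noteq> c' \<longrightarrow> (b + 1, i) \<notin> D"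
    and bot: "(b, c) \<notin> D" "(b, c') \<notin> D"
  shows "\<not> ranked (KD D0) (kohnert_order D0)"
proof -
  note cover = covered_by_kohnert_move[OF D0(1)]
  define A where "A = insert (b, c) (D - {(b + 2, c)})"
  have A: "covered_by (KD D0) (kohnert_order D0) A D"
  proof (rule cover[OF D0(2) top(1) _ _ _ _ _ A_def])
    show "\<forall>u. b < u \<and> u < b + 2 \<longrightarrow> (u, c) \<in> D \<and> (\<exists>i>c. (u, i) \<in> D)"
    proof (intro allI impI)
      fix u assume "b < u \<and> u < b + 2"
      then have "u = b + 1" by simp
      then show "(u, c) \<in> D \<and> (\<exists>i>c. (u, i) \<in> D)" using c mid by auto
    qed
  qed (use b top bot in auto)
  define B where "B = insert (b, c') (A - {(b + 1, c')})"
  have B: "covered_by (KD D0) (kohnert_order D0) B A"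
    by (rule cover[OF covered_by_reachable[OF A] _ _ _ _ _ _ B_def])
      (use b c mid bot in \<open>auto simp: A_def\<close>)
  define E where "E = insert (b, c') (D - {(b + 1, c')})"
  have E: "covered_by (KD D0) (kohnert_order D0) E D"
    by (rule cover[OF D0(2) mid(2) _ _ _ _ _ E_def]) (use b c mid bot in auto)
  define F where "F = insert (b, c) (E - {(b + 1, c)})"
  have F: "covered_by (KD D0) (kohnert_order D0) F E"
    by (rule cover[OF covered_by_reachable[OF E] _ _ _ _ _ _ F_def])
      (use b c mid bot in \<open>auto simp: E_def\<close>)
  have eq: "B = insert (b + 1, c) (F - {(b + 2, c)})"
    using c mid(1) by (auto simp: A_def B_def E_def F_def)
  have "covered_by (KD D0) (kohnert_order D0) B F"
    by (rule cover[OF covered_by_reachable[OF F] _ _ _ _ _ _ eq])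
      (use b c top mid in \<open>auto simp: E_def F_def\<close>)
  with A B E F show ?thesis by (intro not_ranked_if_unequal_chains)
qed

section \<open>Lowering the tail of a row\<close>

text \<open>The cell descends one row at a time and is rightmost in each row that it leaves. Nothing
  is asked to the right of \<open>j\<close> in row \<open>t\<close>, because the cell only lands
  there; this lets several cells be lowered into the same row.\<close>

lemma lower_cell_reachable:
  assumes "is_diagram D" "(s, j) \<in> D" "1 \<le> t" "t < s"
    "\<forall>u. t \<le> u \<and> u < s \<longrightarrow> (u, j) \<notin> D"
    "\<forall>u i. t < u \<and> u \<le> s \<and> j < i \<longrightarrow> (u, i) \<notin> D"
  shows "(D, insert (t, j) (D - {(s, j)})) \<in> kohnert_step\<^sup>*"
  using assms(4,1-3,5-)
proof (induction s arbitrary: D)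
  case (Suc s)
  let ?E = "insert (s, j) (D - {(Suc s, j)})"
  have move: "(D, ?E) \<in> kohnert_step" if "1 \<le> s"
    by (rule kohnert_step_moveI) (use Suc.prems that in auto)
  show ?case
  proof (cases "t = s")
    case True
    then show ?thesis using move Suc.prems(4) by blast
  next
    case False
    then have "t < s" using Suc.prems(1) by simp
    moreover have "is_diagram ?E" using is_diagram_kohnert_steps[OF r_into_rtrancl[OF move] Suc.prems(2)]
        Suc.prems(4) \<open>t < s\<close> by simp
    ultimately have "(?E, insert (t, j) (?E - {(s, j)})) \<in> kohnert_step\<^sup>*"
      by (intro Suc.IH) (use Suc.prems in auto)
    moreover have "insert (t, j) (?E - {(s, j)}) = insert (t, j) (D - {(Suc s, j)})"
      using Suc.prems(1,5) \<open>t < s\<close> by auto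
    ultimately show ?thesis
      using move Suc.prems(4) \<open>t < s\<close> by (simp add: converse_rtrancl_into_rtrancl)
  qed
qed simp

text \<open>Testing \<open>u = t\<close> first makes the operation the identity for
  \<open>s = t\<close>; this covers the case where row \<open>p\<close> below already is row
  \<open>b + 2\<close>.\<close>

definition lower_tail :: "nat \<Rightarrow> nat \<Rightarrow> nat \<Rightarrow> cell set \<Rightarrow> cell set" where
  "lower_tail s t j D = {(u, i). if j \<le> i \<and> u = t then (s, i) \<in> D \<or> (t, i) \<in> D
     else (u, i) \<in> D \<and> \<not> (j \<le> i \<and> u = s)}"

lemma mem_lower_tail:
  "(u, i) \<in> lower_tail s t j D \<longleftrightarrow> (if j \<le> i \<and> u = t then (s, i) \<in> D \<or> (t, i) \<in> D
     else (u, i) \<in> D \<and> \<not> (j \<le> i \<and> u = s))"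
  by (simp add: lower_tail_def)

text \<open>The tail is lowered from right to left: its rightmost cell meets no cell in the rows
  between and has nothing to its right there. The induction is on the number of tail cells still in
  row \<open>s\<close>.\<close>

lemma lower_tail_reachable:
  assumes "is_diagram D" "1 \<le> t" "t \<le> s"
    "\<forall>u i. t < u \<and> u < s \<and> j \<le> i \<longrightarrow> (u, i) \<notin> D"
    "t < s \<Longrightarrow> \<forall>i\<ge>j. (s, i) \<in> D \<longrightarrow> (t, i) \<notin> D"
  shows "(D, lower_tail s t j D) \<in> kohnert_step\<^sup>*"
  using assms
proof (induction "card {i. j \<le> i \<and> (s, i) \<in> D}" arbitrary: D rule: less_induct)
  case less
  let ?T = "\<lambda>D. {i. j \<le> i \<and> (s, i) \<in> D}"
  have "?T D \<subseteq> snd ` D" by force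
  then have fin: "finite (?T D)"
    using less.prems(1) by (auto simp: is_diagram_def intro: finite_subset)
  show ?case
  proof (cases "s = t \<or> ?T D = {}")
    case True
    then have "lower_tail s t j D = D" by (auto simp: lower_tail_def)
    then show ?thesis by simp
  next
    case False
    define m where "m = Max (?T D)"
    have "m \<in> ?T D" using Max_in[OF fin] False unfolding m_def by blast
    then have m: "(s, m) \<in> D" "j \<le> m" by auto
    have max: "(s, i) \<notin> D" if "m < i" for i
      using Max_ge[OF fin, of i] that m(2) unfolding m_def by force
    have "t < s" using False less.prems(3) by simp
    let ?E = "insert (t, m) (D - {(s, m)})"
    have DE: "(D, ?E) \<in> kohnert_step\<^sup>*"
    proof (rule lower_cell_reachable)
      show "\<forall>u. t \<le> u \<and> u < s \<longrightarrow> (u, m) \<notin> D"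
      proof (intro allI impI)
        fix u assume "t \<le> u \<and> u < s"
        then show "(u, m) \<notin> D"
          using less.prems(4,5) m by (cases "u = t") auto
      qed
      show "\<forall>u i. t < u \<and> u \<le> s \<and> m < i \<longrightarrow> (u, i) \<notin> D"
      proof (intro allI impI)
        fix u i assume "t < u \<and> u \<le> s \<and> m < i"
        then show "(u, i) \<notin> D"
          using less.prems(4) m(2) max by (cases "u = s") auto
      qed
    qed (use less.prems m \<open>t < s\<close> in auto)
    have "?T ?E = ?T D - {m}" using \<open>t < s\<close> by auto
    moreover have "card (?T D - {m}) < card (?T D)"
      using fin m by (intro card_Diff1_less) auto
    ultimately have "card (?T ?E) < card (?T D)" by simp
    then have "(?E, lower_tail s t j ?E) \<in> kohnert_step\<^sup>*"
      by (rule less.hyps)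
        (use less.prems \<open>t < s\<close> is_diagram_kohnert_steps[OF DE] in auto)
    moreover have "lower_tail s t j ?E = lower_tail s t j D"
      using m \<open>t < s\<close> by (auto simp: lower_tail_def split: if_splits)
    ultimately show ?thesis using DE by simp
  qed
qed

section \<open>Reaching the two configurations from distant rows\<close>

lemma not_ranked_ascent:
  assumes D0: "is_diagram D0" "(D0, D) \<in> kohnert_step\<^sup>*" and b: "1 \<le> b" "b + 2 \<le> p"
    and cells: "(b + 1, c) \<in> D" "(p, c) \<in> D" "(p, c + 1) \<in> D"
    and low: "\<forall>i\<ge>c. (b, i) \<notin> D" "\<forall>i\<ge>c + 2. (b + 1, i) \<notin> D"
    and between: "\<forall>u i. b + 1 < u \<and> u < p \<and> c \<le> i \<longrightarrow> (u, i) \<notin> D"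
  shows "\<not> ranked (KD D0) (kohnert_order D0)"
proof -
  have dia: "is_diagram E" if "(D0, E) \<in> kohnert_step\<^sup>*" for E
    using is_diagram_kohnert_steps that D0(1) .
  \<comment> \<open>Only column \<open>c + 1\<close> can be occupied here; afterwards
    \<open>(b + 1, c)\<close> is rightmost in its row.\<close>
  define D1 where "D1 = lower_tail (b + 1) b (c + 1) D"
  have "(D, D1) \<in> kohnert_step\<^sup>*" unfolding D1_def
    by (rule lower_tail_reachable[OF dia[OF D0(2)]]) (use b low in auto)
  then have R1: "(D0, D1) \<in> kohnert_step\<^sup>*" using D0(2) by (meson rtrancl_trans)
  have mem1: "(u, i) \<in> D1 \<longleftrightarrow> (if c + 1 \<le> i \<and> u = b then (b + 1, i) \<in> D \<or> (b, i) \<in> D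
     else (u, i) \<in> D \<and> \<not> (c + 1 \<le> i \<and> u = b + 1))" for u i
    unfolding D1_def by (rule mem_lower_tail)
  \<comment> \<open>The surplus of row \<open>p\<close> goes all the way to row \<open>b\<close>,
    since in row \<open>b + 1\<close> it would spoil the rightmost position of
    \<open>(b + 1, c)\<close>. Column \<open>c\<close> of row \<open>b\<close> stays empty.\<close>
  define D2 where "D2 = lower_tail p b (c + 2) D1"
  have "(D1, D2) \<in> kohnert_step\<^sup>*" unfolding D2_def
  proof (rule lower_tail_reachable[OF dia[OF R1]])
    show "\<forall>u i. b < u \<and> u < p \<and> c + 2 \<le> i \<longrightarrow> (u, i) \<notin> D1"
    proof (intro allI impI)
      fix u i assume "b < u \<and> u < p \<and> c + 2 \<le> i"
      then show "(u, i) \<notin> D1" using between by (cases "u = b + 1") (auto simp: mem1)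
    qed
  qed (use b low in \<open>auto simp: mem1\<close>)
  then have R2: "(D0, D2) \<in> kohnert_step\<^sup>*" using R1 by (meson rtrancl_trans)
  have mem2: "(u, i) \<in> D2 \<longleftrightarrow> (if c + 2 \<le> i \<and> u = b then (p, i) \<in> D1 \<or> (b, i) \<in> D1
     else (u, i) \<in> D1 \<and> \<not> (c + 2 \<le> i \<and> u = p))" for u i
    unfolding D2_def by (rule mem_lower_tail)
  \<comment> \<open>From column \<open>c\<close> on, row \<open>p\<close> now consists of columns
    \<open>c\<close> and \<open>c + 1\<close>; with these in row \<open>b + 2\<close> the arriving
    configuration is complete.\<close>
  define D3 where "D3 = lower_tail p (b + 2) c D2"
  have "(D2, D3) \<in> kohnert_step\<^sup>*" unfolding D3_def
    by (rule lower_tail_reachable[OF dia[OF R2]]) (use b between in \<open>auto simp: mem1 mem2\<close>)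
  then have R3: "(D0, D3) \<in> kohnert_step\<^sup>*" using R2 by (meson rtrancl_trans)
  have mem3: "(u, i) \<in> D3 \<longleftrightarrow> (if c \<le> i \<and> u = b + 2 then (p, i) \<in> D2 \<or> (b + 2, i) \<in> D2
     else (u, i) \<in> D2 \<and> \<not> (c \<le> i \<and> u = p))" for u i
    unfolding D3_def by (rule mem_lower_tail)
  show ?thesis
  proof (rule not_ranked_arriving[OF D0(1) R3 b(1), of c "c + 1"])
    show "\<forall>i>c. i \<noteq> c + 1 \<longrightarrow> (b + 2, i) \<notin> D3"
    proof (intro allI impI)
      fix i assume "c < i" "i \<noteq> c + 1"
      then show "(b + 2, i) \<notin> D3"
        using b between by (cases "b + 2 = p") (auto simp: mem1 mem2 mem3)
    qed
  qed (use b cells low in \<open>auto simp: mem1 mem2 mem3\<close>)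
qed

lemma not_ranked_descent:
  assumes D0: "is_diagram D0" "(D0, D) \<in> kohnert_step\<^sup>*" and b: "1 \<le> b" "b + 2 \<le> p"
    and cells: "(b + 1, c) \<in> D" "(b + 1, c + 1) \<in> D" "(p, c) \<in> D"
    and low: "\<forall>i\<ge>c. (b, i) \<notin> D" and top: "\<forall>i>c. (p, i) \<notin> D"
    and between: "\<forall>u i. b + 1 < u \<and> u < p \<and> c \<le> i \<longrightarrow> (u, i) \<notin> D"
  shows "\<not> ranked (KD D0) (kohnert_order D0)"
proof -
  have dia: "is_diagram E" if "(D0, E) \<in> kohnert_step\<^sup>*" for E
    using is_diagram_kohnert_steps that D0(1) .
  \<comment> \<open>This leaves \<open>(b + 1, c + 1)\<close> as the only cell to the right of
    \<open>(b + 1, c)\<close>, with \<open>(b, c)\<close> and \<open>(b, c + 1)\<close> still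
    empty.\<close>
  define D1 where "D1 = lower_tail (b + 1) b (c + 2) D"
  have "(D, D1) \<in> kohnert_step\<^sup>*" unfolding D1_def
    by (rule lower_tail_reachable[OF dia[OF D0(2)]]) (use b low in auto)
  then have R1: "(D0, D1) \<in> kohnert_step\<^sup>*" using D0(2) by (meson rtrancl_trans)
  have mem1: "(u, i) \<in> D1 \<longleftrightarrow> (if c + 2 \<le> i \<and> u = b then (b + 1, i) \<in> D \<or> (b, i) \<in> D
     else (u, i) \<in> D \<and> \<not> (c + 2 \<le> i \<and> u = b + 1))" for u i
    unfolding D1_def by (rule mem_lower_tail)
  define D2 where "D2 = lower_tail p (b + 2) c D1"
  have "(D1, D2) \<in> kohnert_step\<^sup>*" unfolding D2_def
    by (rule lower_tail_reachable[OF dia[OF R1]]) (use b between in \<open>auto simp: mem1\<close>)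
  then have R2: "(D0, D2) \<in> kohnert_step\<^sup>*" using R1 by (meson rtrancl_trans)
  have mem2: "(u, i) \<in> D2 \<longleftrightarrow> (if c \<le> i \<and> u = b + 2 then (p, i) \<in> D1 \<or> (b + 2, i) \<in> D1
     else (u, i) \<in> D1 \<and> \<not> (c \<le> i \<and> u = p))" for u i
    unfolding D2_def by (rule mem_lower_tail)
  show ?thesis
  proof (rule not_ranked_leaving[OF D0(1) R2 b(1), of c "c + 1"])
    show "\<forall>i>c. (b + 2, i) \<notin> D2"
    proof (intro allI impI)
      fix i assume "c < i"
      then show "(b + 2, i) \<notin> D2"
        using b top between by (cases "b + 2 = p") (auto simp: mem1 mem2)
    qed
  qed (use b cells low in \<open>auto simp: mem1 mem2 split: if_splits\<close>)
qed

section \<open>Minimal bad triples\<close>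

definition bad_triple :: "(nat \<Rightarrow> nat) \<Rightarrow> nat \<Rightarrow> nat \<Rightarrow> nat \<Rightarrow> bool" where
  "bad_triple f j1 j2 j3 \<longleftrightarrow> j1 < j2 \<and> j2 < j3 \<and>
     (f j1 < f j2 \<and> f j2 < f j3 \<or> f j1 < f j3 \<and> f j3 < f j2 \<or> f j1 + 1 < f j2 \<and> f j2 = f j3)"

lemma ex_last_nat_less:
  fixes n k :: nat
  assumes "k < n" "P k"
  shows "\<exists>m<n. k \<le> m \<and> P m \<and> (\<forall>l. m < l \<and> l < n \<longrightarrow> \<not> P l)"
proof -
  let ?S = "{m. m < n \<and> P m}"
  have S: "finite ?S" "k \<in> ?S" using assms by auto
  define m where "m = Max ?S"
  have "m \<in> ?S" using S unfolding m_def by (intro Max_in) auto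
  moreover have "l \<le> m" if "l \<in> ?S" for l using Max_ge[OF S(1) that] unfolding m_def .
  ultimately show ?thesis using S(2) leD by (intro exI[of _ m]) blast
qed

text \<open>In each shape \<open>c\<close> is a column missing in row \<open>i\<close> and in all
  rows between \<open>q\<close> and \<open>p\<close>, but present in rows \<open>q\<close> and
  \<open>p\<close>. The indices are chosen as late as possible, and any other value in between would
  give a bad triple ending before \<open>p\<close>.\<close>

lemma minimal_bad_triple_shape:
  assumes bad: "bad_triple f j1 j2 p" and min: "\<And>i j k. k < p \<Longrightarrow> \<not> bad_triple f i j k"
  obtains i q c where "i < q" "q < p" "f i < c" "\<And>k. q < k \<Longrightarrow> k < p \<Longrightarrow> f k < c"
    "\<And>k. i < k \<Longrightarrow> k < q \<Longrightarrow> f k = c" "f q = c" "c < f p"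
  | i q c where "q = i + 1" "q < p" "f i < c" "\<And>k. q < k \<Longrightarrow> k < p \<Longrightarrow> f k < c"
    "f q = c + 1" "f p = c + 1"
  | i q c where "q = i + 1" "q < p" "f i < c" "\<And>k. q < k \<Longrightarrow> k < p \<Longrightarrow> f k < c"
    "c < f q" "f p = c"
proof -
  have j: "j1 < j2" "j2 < p" using bad by (auto simp: bad_triple_def)
  consider "f j1 < f j2" "f j2 < f p" | "f j1 < f p" "f p < f j2" | "f j1 + 1 < f j2" "f j2 = f p"
    using bad by (auto simp: bad_triple_def)
  then show thesis
  proof cases
    case 1
    obtain q where q: "q < p" "\<exists>i<q. f i < f q \<and> f q < f p"
      "\<And>l. q < l \<Longrightarrow> l < p \<Longrightarrow> \<not> (\<exists>i<l. f i < f l \<and> f l < f p)"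
      using ex_last_nat_less[of j2 p "\<lambda>q. \<exists>i<q. f i < f q \<and> f q < f p"] j 1 by blast
    then obtain i0 where i0: "i0 < q" "f i0 < f q" "f q < f p" by blast
    obtain i where i: "i < q" "f i < f q" "\<And>l. i < l \<Longrightarrow> l < q \<Longrightarrow> \<not> f l < f q"
      using ex_last_nat_less[of i0 q "\<lambda>l. f l < f q"] i0 by blast
    show thesis
    proof (rule that(1)[of i q "f q"])
      show "f k < f q" if "q < k" "k < p" for k
      proof -
        have "i < k" using i(1) that by simp
        then have "\<not> (f i < f k \<and> f k < f p)" using q(3)[OF that] by blast
        then show ?thesis
          using min[of k i q] i0(3) i(1,2) that unfolding bad_triple_def by linarith
      qed
      \<comment> \<open>In the instances of \<open>min\<close> the last index of the triple comes
        first: here the triple is \<open>i < k < q\<close>.\<close>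
      show "f k = f q" if "i < k" "k < q" for k
        using min[of q i k] i(2) i(3)[of k] q(1) that unfolding bad_triple_def by linarith
    qed (use q(1) i0(3) i(1,2) in auto)
  next
    case 2
    obtain q where q: "q < p" "j2 \<le> q" "f p < f q" "\<And>l. q < l \<Longrightarrow> l < p \<Longrightarrow> \<not> f p < f l"
      using ex_last_nat_less[of j2 p "\<lambda>q. f p < f q"] j 2 by blast
    obtain i where i: "i < q" "f i < f p" "\<And>l. i < l \<Longrightarrow> l < q \<Longrightarrow> \<not> f l < f p"
      using ex_last_nat_less[of j1 q "\<lambda>l. f l < f p"] j(1) q(2) 2(1) by (auto simp del: not_less)
    \<comment> \<open>Otherwise \<open>f (i + 1)\<close> is at least \<open>f p\<close>, and since
      \<open>f i < f p < f q\<close>, the triple \<open>i < i + 1 < q\<close> is bad however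
      \<open>f (i + 1)\<close> compares with \<open>f q\<close>.\<close>
    have "q = i + 1"
    proof (rule ccontr)
      assume "q \<noteq> i + 1"
      then have "i < i + 1" "i + 1 < q" using i(1) by auto
      then show False
        using min[of q i "i + 1"] i(2) i(3)[of "i + 1"] q(1,3) unfolding bad_triple_def by linarith
    qed
    then show thesis
    proof (rule that(3)[of q i "f p"])
      show "f k < f p" if "q < k" "k < p" for k
        using min[of k i q] q(3) q(4)[of k] i(1,2) that unfolding bad_triple_def by linarith
    qed (use q(1,3) i(2) in auto)
  next
    case 3
    obtain i where i: "i < j2" "f i + 1 < f j2" "\<And>l. i < l \<Longrightarrow> l < j2 \<Longrightarrow> \<not> f l + 1 < f j2"
      using ex_last_nat_less[of j1 j2 "\<lambda>l. f l + 1 < f j2"] j(1) 3(1) by blast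
    have "j2 = i + 1"
    proof (rule ccontr)
      assume "j2 \<noteq> i + 1"
      then have "i < i + 1" "i + 1 < j2" using i(1) by auto
      then show False
        using min[of j2 i "i + 1"] i(2) i(3)[of "i + 1"] j(2) unfolding bad_triple_def by linarith
    qed
    obtain q where q: "q < p" "j2 \<le> q" "f q = f p" "\<And>l. q < l \<Longrightarrow> l < p \<Longrightarrow> f l \<noteq> f p"
      using ex_last_nat_less[of j2 p "\<lambda>q. f q = f p"] j(2) 3(2) by blast
    have "q = j2"
      using min[of q i j2] i(1,2) q(1-3) 3(2) unfolding bad_triple_def by linarith
    with \<open>j2 = i + 1\<close> have "q = i + 1" by simp
    then show thesis
    \<comment> \<open>Column \<open>f p - 1\<close> is chosen so that rows \<open>q\<close> and
      \<open>p\<close> both reach the next column, while the gap of two keeps row \<open>i\<close>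
      short of it.\<close>
    proof (rule that(2)[of q i "f p - 1"])
      show "f k < f p - 1" if "q < k" "k < p" for k
        using min[of k i q] q(3) q(4)[of k] i(1,2) \<open>q = j2\<close> that 3
        unfolding bad_triple_def by linarith
    qed (use q(1,3) i(2) 3 \<open>q = j2\<close> in auto)
  qed
qed

section \<open>Application to key diagrams\<close>

lemma mem_key_diagram: "(r, c) \<in> key_diagram a \<longleftrightarrow> 1 \<le> r \<and> r \<le> length a \<and> 1 \<le> c \<and> c \<le> a ! (r - 1)"
  by (auto simp: key_diagram_def)

theorem theorem6p13:
  fixes a :: "nat list"
  assumes "\<not> pure_composition a"
  shows "\<not> ranked (KD (key_diagram a)) (kohnert_order (key_diagram a))"
proof -
  let ?D = "key_diagram a" and ?f = "(!) a"
  note dia = is_diagram_key_diagram[of a]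
  let ?Q = "\<lambda>p. p < length a \<and> (\<exists>j1 j2. bad_triple ?f j1 j2 p)"
  define p where "p = (LEAST p. ?Q p)"
  have "\<exists>p. ?Q p" using assms unfolding pure_composition_def bad_triple_def by blast
  then have "?Q p" unfolding p_def by (rule LeastI_ex)
  then obtain j1 j2 where p: "p < length a" and bad: "bad_triple ?f j1 j2 p" by blast
  have min: "\<not> bad_triple ?f i j k" if "k < p" for i j k
    using not_less_Least[of k ?Q] that p unfolding p_def[symmetric] by auto
  have mem: "(Suc r, i) \<in> ?D \<longleftrightarrow> r < length a \<and> 1 \<le> i \<and> i \<le> a ! r" for r i
    by (auto simp: mem_key_diagram)
  show ?thesis
    using bad min
  proof (rule minimal_bad_triple_shape)
    fix i q c
    assume iq: "i < q" "q < p" "a ! i < c" and above: "\<And>k. q < k \<Longrightarrow> k < p \<Longrightarrow> a ! k < c"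
      and eq: "\<And>k. i < k \<Longrightarrow> k < q \<Longrightarrow> a ! k = c" and q: "a ! q = c" and "c < a ! p"
    \<comment> \<open>Index \<open>k\<close> is row \<open>k + 1\<close>, so row \<open>q\<close>
      belongs to index \<open>q - 1\<close>. If that index is not \<open>i\<close>, the row ends at
      column \<open>c\<close>, and one move clears its last cell: it jumps over the rows between,
      which all contain column \<open>c\<close>, into row \<open>i + 1\<close>.\<close>
    define E where "E = (if q = i + 1 then ?D else insert (Suc i, c) (?D - {(q, c)}))"
    have between: "(u, l) \<notin> ?D" if "q + 1 < u" "u < p + 1" "c \<le> l" for u l
      using above[of "u - 1"] that by (cases u) (auto simp: mem)
    obtain q' where q': "q = Suc q'" using iq by (cases q) auto
    have RE: "(?D, E) \<in> kohnert_step\<^sup>*"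
    proof (cases "q = i + 1")
      case False
      then have "i < q'" using iq q' by simp
      have "(?D, insert (Suc i, c) (?D - {(q, c)})) \<in> kohnert_step"
      proof (rule kohnert_step_moveI[OF dia])
        show "\<forall>u. Suc i < u \<and> u < q \<longrightarrow> (u, c) \<in> ?D"
        proof (intro allI impI)
          fix u assume u: "Suc i < u \<and> u < q"
          then obtain u' where "u = Suc u'" by (cases u) auto
          then show "(u, c) \<in> ?D" using u eq[of u'] iq p by (simp add: mem)
        qed
      qed (use \<open>i < q'\<close> iq eq[of q'] p in \<open>auto simp: q' mem\<close>)
      then show ?thesis using False unfolding E_def by auto
    qed (simp add: E_def)
    show ?thesis
    proof (rule not_ranked_ascent[OF dia RE, of q "p + 1" c])
      show "\<forall>l\<ge>c. (q, l) \<notin> E"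
        using iq eq[of q'] q' by (cases "q = i + 1") (auto simp: E_def mem)
      show "\<forall>u l. q + 1 < u \<and> u < p + 1 \<and> c \<le> l \<longrightarrow> (u, l) \<notin> E"
        using between iq unfolding E_def by auto
    qed (use iq p q \<open>c < a ! p\<close> in \<open>auto simp: E_def mem\<close>)
  next
    fix i q c
    assume iq: "q = i + 1" "q < p" "a ! i < c" and above: "\<And>k. q < k \<Longrightarrow> k < p \<Longrightarrow> a ! k < c"
      and q: "a ! q = c + 1" "a ! p = c + 1"
    have between: "(u, l) \<notin> ?D" if "q + 1 < u" "u < p + 1" "c \<le> l" for u l
      using above[of "u - 1"] that by (cases u) (auto simp: mem)
    show ?thesis
      by (rule not_ranked_ascent[OF dia rtrancl_refl, of q "p + 1" c])
        (use iq p q between in \<open>auto simp: mem\<close>)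
  next
    fix i q c
    assume iq: "q = i + 1" "q < p" "a ! i < c" and above: "\<And>k. q < k \<Longrightarrow> k < p \<Longrightarrow> a ! k < c"
      and q: "c < a ! q" "a ! p = c"
    have between: "(u, l) \<notin> ?D" if "q + 1 < u" "u < p + 1" "c \<le> l" for u l
      using above[of "u - 1"] that by (cases u) (auto simp: mem)
    show ?thesis
      \<comment> \<open>Here \<open>b = q\<close> is the row of index \<open>i\<close>, so it is
        empty from column \<open>c\<close> on; rows \<open>b + 1\<close> and \<open>p + 1\<close>
        belong to indices \<open>q\<close> and \<open>p\<close>.\<close>
      by (rule not_ranked_descent[OF dia rtrancl_refl, of q "p + 1" c])
        (use iq p q between in \<open>auto simp: mem\<close>)
  qed
qed

end
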